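(* Let $X$ be a vector field on an $m$-dimensional manifold, let $e$ be a hyperbolic equilibrium of $X$ with linearisation $JX_e$, let $p$ be the characteristic polynomial of $JX_e$, and let $\alpha,\beta,\gamma,\delta$ be the spectral indices of $e$. Then $\gamma$ and $\delta$ can be computed using Sturm's theorem: if $p$ has only simple roots, and $p_0,p_1,\dots,p_k$ is the Sturm sequence of $p$, with $a_j$ the constant term and $b_j$ the leading coefficient of $p_j$, then $$\gamma=\operatorname{var}(a_0,\dots,a_k)-\operatorname{var}(b_0,\dots,b_k),\qquad \delta=\operatorname{var}\bigl((-1)^{\deg p_0}b_0,\dots,(-1)^{\deg p_k}b_k\bigr)-\operatorname{var}(a_0,\dots,a_k).$$ Moreover, $$\alpha=\frac12\left(\frac m2-\operatorname{wind}(p_r+i\,p_i)-\gamma\right),\qquad \beta=\frac12\left(\frac m2+\operatorname{wind}(p_r+i\,p_i)-\delta\right).$$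
   Context: The linearisation of $X$ at $e$ is $\dot x=JX_e\,x$, with $JX_e$ the Jacobian matrix of $X$ at $e$; $e$ is hyperbolic if no eigenvalue of $JX_e$ has zero real part. The characteristic polynomial is $p(\lambda)=\det(JX_e-\lambda I)=(-1)^m\lambda^m+(-1)^{m-1}d_1\lambda^{m-1}+\cdots-d_{m-1}\lambda+d_m$, with $d_1,\dots,d_m\in\mathbb R$ the principal invariants of $JX_e$. Spectral indices (eigenvalues counted with multiplicity): $\alpha$ (resp. $\beta$) is the number of pairs of complex conjugate non-real eigenvalues of $JX_e$ with positive (resp. negative) real part; $\gamma$ (resp. $\delta$) is the number of positive (resp. negative) real eigenvalues of $JX_e$. Sturm sequence: $p_0=p$, $p_1=p'$, and $p_j=-\operatorname{rem}(p_{j-2},p_{j-1})$ for $j\ge2$, where $\operatorname{rem}(f,g)$ is the remainder of the Euclidean division of $f$ by $g$; $p_k$ is the last non-zero term (generically $k=m$ and $\deg p_j=m-j$). For a finite list of real numbers, $\operatorname{var}$ is the number of changes of sign between consecutive elements of the list once the zeroes have been removed. Winding number: $p_r,p_i$ are the real polynomials such that $p(is)=p_r(s)+i\,p_i(s)$ for $s\in\mathbb R$. Since $e$ is hyperbolic, the curve $\mathbb R\to\mathbb C\setminus\{0\}$, $s\mapsto p_r(s)+i\,p_i(s)=p(is)$, does not pass through $0$, and its winding number around zero is $$\operatorname{wind}(p_r+i\,p_i)=\frac1{2\pi}\int_{-\infty}^{+\infty}\frac{p_i'(s)p_r(s)-p_r'(s)p_i(s)}{p_r(s)^2+p_i(s)^2}\,ds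 ,$$ that is, $1/(2\pi)$ times the total variation of a continuous argument of $p(is)$ as $s$ goes from $-\infty$ to $+\infty$ (it is an integer if $m$ is even and a half-integer if $m$ is odd). *)

theory Defs
  imports "HOL-Analysis.Analysis" "HOL-Computational_Algebra.Polynomial"
begin

section \<open>Manifolds, vector fields and their linearisation\<close>

text \<open>
  A map between Euclidean spaces is of class C^k on an open set if its iterated partial derivatives
  up to order k exist and are continuous. Only open sets \<open>S\<close> are meant.
\<close>

primrec Ck_on :: "nat \<Rightarrow> (real^('m::finite)) set \<Rightarrow> (real^'m \<Rightarrow> real^'m) \<Rightarrow> bool" where
  "Ck_on 0 S f \<longleftrightarrow> continuous_on S f"
| "Ck_on (Suc k) S f \<longleftrightarrow> f differentiable_on S \<and>
     (\<forall>j. Ck_on k S (\<lambda>x. frechet_derivative f (at x) (axis j 1)))"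

text \<open>A chart is its domain together with its coordinate map, which is unconstrained off the domain.\<close>

type_synonym ('a, 'm) chart = "'a set \<times> ('a \<Rightarrow> real^'m)"

abbreviation chart_domain :: "('a, 'm::finite) chart \<Rightarrow> 'a set" where
  "chart_domain c \<equiv> fst c"

abbreviation chart_map :: "('a, 'm::finite) chart \<Rightarrow> 'a \<Rightarrow> real^'m" where
  "chart_map c \<equiv> snd c"

definition chart_inv :: "('a, 'm::finite) chart \<Rightarrow> real^'m \<Rightarrow> 'a" where
  "chart_inv c = inv_into (chart_domain c) (chart_map c)"

definition chart_on :: "'a topology \<Rightarrow> ('a, 'm::finite) chart \<Rightarrow> bool" where
  "chart_on T c \<longleftrightarrow> openin T (chart_domain c) \<and> open (chart_map c ` chart_domain c) \<and>
     homeomorphic_map (subtopology T (chart_domain c))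
       (top_of_set (chart_map c ` chart_domain c)) (chart_map c)"

definition transition :: "('a, 'm::finite) chart \<Rightarrow> ('a, 'm) chart \<Rightarrow> real^'m \<Rightarrow> real^'m" where
  "transition c d = chart_map d \<circ> chart_inv c"

text \<open>The dimension of the manifold is \<open>CARD('m)\<close>.\<close>

definition smooth_manifold :: "'a topology \<Rightarrow> ('a, 'm::finite) chart set \<Rightarrow> bool" where
  "smooth_manifold T A \<longleftrightarrow> Hausdorff_space T \<and> second_countable T \<and>
     (\<forall>c\<in>A. chart_on T c) \<and> topspace T = (\<Union>c\<in>A. chart_domain c) \<and>
     (\<forall>c\<in>A. \<forall>d\<in>A. \<forall>k.
        Ck_on k (chart_map c ` (chart_domain c \<inter> chart_domain d)) (transition c d))"

text \<open>
  Tangent vectors are given by their components in each chart: \<open>X c q\<close> is the component vector of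
  the field at the point \<open>q\<close> in the chart \<open>c\<close>, and a change of chart acts by the derivative of the
  transition map. The field is required to be of class C^1.
\<close>

definition local_rep :: "('a, 'm::finite) chart \<Rightarrow> (('a, 'm) chart \<Rightarrow> 'a \<Rightarrow> real^'m) \<Rightarrow> real^'m \<Rightarrow> real^'m" where
  "local_rep c X = X c \<circ> chart_inv c"

definition vector_field_on :: "('a, 'm::finite) chart set \<Rightarrow> (('a, 'm) chart \<Rightarrow> 'a \<Rightarrow> real^'m) \<Rightarrow> bool" where
  "vector_field_on A X \<longleftrightarrow>
     (\<forall>c\<in>A. Ck_on 1 (chart_map c ` chart_domain c) (local_rep c X)) \<and>
     (\<forall>c\<in>A. \<forall>d\<in>A. \<forall>q\<in>chart_domain c \<inter> chart_domain d.
        X d q = frechet_derivative (transition c d) (at (chart_map c q)) (X c q))"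

text \<open>
  The Jacobian matrix of \<open>X\<close> at \<open>e\<close> in the coordinates of \<open>c\<close>. At an equilibrium, the matrices
  obtained from two charts around \<open>e\<close> are similar.
\<close>

definition linearisation ::
    "('a, 'm::finite) chart \<Rightarrow> (('a, 'm) chart \<Rightarrow> 'a \<Rightarrow> real^'m) \<Rightarrow> 'a \<Rightarrow> real^'m^'m" where
  "linearisation c X e = jacobian (local_rep c X) (at (chart_map c e))"

section \<open>Eigenvalues and spectral indices\<close>

definition eigenvalue :: "real^('m::finite)^'m \<Rightarrow> complex \<Rightarrow> bool" where
  "eigenvalue J l \<longleftrightarrow> (\<exists>v. v \<noteq> 0 \<and> map_matrix complex_of_real J *v v = l *s v)"

text \<open>
  Vanishing of \<open>X\<close> at \<open>e\<close> and the eigenvalues of the linearisation do not depend on the chart \<open>c\<close>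
  around \<open>e\<close>.
\<close>

definition hyperbolic_equilibrium ::
    "('a, 'm::finite) chart \<Rightarrow> (('a, 'm) chart \<Rightarrow> 'a \<Rightarrow> real^'m) \<Rightarrow> 'a \<Rightarrow> bool" where
  "hyperbolic_equilibrium c X e \<longleftrightarrow>
     X c e = 0 \<and> (\<forall>l. eigenvalue (linearisation c X e) l \<longrightarrow> Re l \<noteq> 0)"

text \<open>\<open>det (J - \<lambda> I)\<close>, with leading coefficient \<open>(- 1) ^ CARD('m)\<close>.\<close>

definition characteristic_poly :: "real^('m::finite)^'m \<Rightarrow> real poly" where
  "characteristic_poly J = det (map_matrix (\<lambda>a. [:a:]) J - mat [:0, 1:])"

abbreviation complex_poly :: "real poly \<Rightarrow> complex poly" where
  "complex_poly \<equiv> map_poly complex_of_real"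

definition alg_mult :: "real^('m::finite)^'m \<Rightarrow> complex \<Rightarrow> nat" where
  "alg_mult J l = order l (complex_poly (characteristic_poly J))"

text \<open>
  A pair of conjugate non-real eigenvalues is represented by its member in the upper half plane;
  both members have the same multiplicity.
\<close>

definition alpha_index :: "real^('m::finite)^'m \<Rightarrow> nat" where
  "alpha_index J = (\<Sum>l | eigenvalue J l \<and> Im l > 0 \<and> Re l > 0. alg_mult J l)"

definition beta_index :: "real^('m::finite)^'m \<Rightarrow> nat" where
  "beta_index J = (\<Sum>l | eigenvalue J l \<and> Im l > 0 \<and> Re l < 0. alg_mult J l)"

definition gamma_index :: "real^('m::finite)^'m \<Rightarrow> nat" where
  "gamma_index J = (\<Sum>l | eigenvalue J l \<and> Im l = 0 \<and> Re l > 0. alg_mult J l)"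

definition delta_index :: "real^('m::finite)^'m \<Rightarrow> nat" where
  "delta_index J = (\<Sum>l | eigenvalue J l \<and> Im l = 0 \<and> Re l < 0. alg_mult J l)"

section \<open>Sturm sequence, sign changes and winding number\<close>

text \<open>\<open>signed_remainders f g\<close> is \<open>f, g, - (f mod g), \<dots>\<close>, ending with the last non-zero term.\<close>

function signed_remainders :: "real poly \<Rightarrow> real poly \<Rightarrow> real poly list" where
  "signed_remainders f g = (if g = 0 then [f] else f # signed_remainders g (- (f mod g)))"
  by auto
termination
  by (relation "Wellfounded.measure (\<lambda>(f, g). if g = 0 then 0 else Suc (degree g))")
     (use degree_mod_less in auto)

declare signed_remainders.simps [simp del]

definition sturm_sequence :: "real poly \<Rightarrow> real poly list" where
  "sturm_sequence p = signed_remainders p (pderiv p)"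

definition sign_var :: "real list \<Rightarrow> nat" where
  "sign_var xs = (let ys = filter (\<lambda>x. x \<noteq> 0) xs
     in card {i. Suc i < length ys \<and> sgn (ys ! i) \<noteq> sgn (ys ! Suc i)})"

text \<open>The real and imaginary parts of the polynomial \<open>p (\<i> s)\<close> in the real variable \<open>s\<close>.\<close>

definition re_part :: "real poly \<Rightarrow> real poly" where
  "re_part p = map_poly Re (pcompose (complex_poly p) [:0, \<i>:])"

definition im_part :: "real poly \<Rightarrow> real poly" where
  "im_part p = map_poly Im (pcompose (complex_poly p) [:0, \<i>:])"

lemma poly_re_im_of_real:
  fixes q :: "complex poly"
  shows "poly q (of_real s) = Complex (poly (map_poly Re q) s) (poly (map_poly Im q) s)"
proof (induction q)
  case (pCons a q)
  have "map_poly Re (pCons a q) = pCons (Re a) (map_poly Re q)"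
    "map_poly Im (pCons a q) = pCons (Im a) (map_poly Im q)"
    by (simp_all add: poly_eq_iff coeff_map_poly coeff_pCons split: nat.splits)
  with pCons show ?case
    by (simp add: complex_eq_iff)
qed (simp add: complex_eq_iff)

lemma poly_imaginary_axis:
  "poly (complex_poly p) (\<i> * of_real s) = of_real (poly (re_part p) s) + \<i> * of_real (poly (im_part p) s)"
proof -
  have "poly (complex_poly p) (\<i> * of_real s) = poly (pcompose (complex_poly p) [:0, \<i>:]) (of_real s)"
    by (simp add: poly_pcompose mult.commute)
  then show ?thesis
    unfolding poly_re_im_of_real by (simp add: re_part_def im_part_def complex_eq_iff)
qed

definition wind :: "real poly \<Rightarrow> real poly \<Rightarrow> real" where
  "wind f g = 1 / (2 * pi) * integral UNIV
     (\<lambda>s. (poly (pderiv g) s * poly f s - poly (pderiv f) s * poly g s)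
           / ((poly f s)\<^sup>2 + (poly g s)\<^sup>2))"

end

theory Submission
  imports Defs "HOL-Computational_Algebra.Fundamental_Theorem_Algebra" "HOL-Real_Asymp.Real_Asymp"
begin

text \<open>
  The number of sign variations of the Sturm sequence of a polynomial with simple roots is locally
  constant away from the roots and drops by one on reaching a root from the left. Comparing its values at
  zero and near plus or minus infinity gives \<open>\<gamma>\<close> and \<open>\<delta>\<close>.

  The integrand of the winding number of \<open>p (\<i> s)\<close> is the real part of the logarithmic derivative
  \<open>p' (\<i> s) / p (\<i> s)\<close>, the sum of \<open>1 / (\<i> s - z)\<close> over the roots \<open>z\<close> of \<open>p\<close>. A root contributes
  \<open>- sgn (Re z) / 2\<close>, so the winding number is half the difference of the numbers of roots in the
  left and right half planes, which are \<open>2 \<beta> + \<delta>\<close> and \<open>2 \<alpha> + \<gamma>\<close> and add up to \<open>m\<close>.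
\<close>

section \<open>Sturm's theorem\<close>

lemma sign_var_Cons_zero [simp]: "sign_var (0 # xs) = sign_var xs"
  by (simp add: sign_var_def)

lemma sign_var_Cons_Cons_zero [simp]: "sign_var (x # 0 # xs) = sign_var (x # xs)"
  by (simp add: sign_var_def)

lemma sign_var_singleton [simp]: "sign_var [x] = 0"
  by (simp add: sign_var_def)

lemma sign_var_Cons_Cons:
  assumes "x \<noteq> 0" "y \<noteq> 0"
  shows "sign_var (x # y # xs) = (if sgn x = sgn y then 0 else 1) + sign_var (y # xs)"
proof -
  define ys where "ys = y # filter (\<lambda>x. x \<noteq> 0) xs"
  define I where "I = (\<lambda>zs. {i. Suc i < length zs \<and> sgn (zs ! i) \<noteq> sgn (zs ! Suc i :: real)})"
  have "I (x # ys) = (if sgn x = sgn y then {} else {0}) \<union> Suc ` I ys"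
  proof (rule set_eqI)
    show "i \<in> I (x # ys) \<longleftrightarrow> i \<in> (if sgn x = sgn y then {} else {0}) \<union> Suc ` I ys" for i
      by (cases i) (auto simp: I_def ys_def)
  qed
  moreover have "finite (I ys)"
    by (rule finite_subset[of _ "{..<length ys}"]) (auto simp: I_def)
  ultimately have "card (I (x # ys)) = (if sgn x = sgn y then 0 else 1) + card (I ys)"
    by (simp add: card_image)
  then show ?thesis
    using assms by (simp add: sign_var_def I_def ys_def)
qed

text \<open>Only the sign of the head enters the count. Equality of non-zero signs is written as a
  positive product because continuity delivers it in that form.\<close>

lemma sign_var_Cons_pos_mult:
  assumes "x * y > 0"
  shows "sign_var (x # xs) = sign_var (y # xs)"
proof -
  have "sgn x = sgn y" and "x \<noteq> 0" "y \<noteq> 0"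
    using assms by (auto simp: zero_less_mult_iff)
  then show ?thesis
  proof (induction xs)
    case (Cons z xs)
    then show ?case
      by (cases "z = 0") (simp_all add: sign_var_Cons_Cons)
  qed simp
qed

lemma sign_var_map_sgn: "sign_var (map sgn xs) = sign_var xs"
proof -
  have "filter (\<lambda>x. x \<noteq> 0) (map sgn xs) = map sgn (filter (\<lambda>x. x \<noteq> 0) xs)"
    by (induction xs) (auto simp: sgn_zero_iff)
  then show ?thesis
    by (auto simp: sign_var_def Let_def intro!: arg_cong[where f=card])
qed

text \<open>Between opposite signs there is exactly one change, whatever the sign of
  \<open>y\<close>. This is why the vanishing of an inner term of a Sturm sequence leaves the count
  unaltered.\<close>

lemma sign_var_insert_between:
  assumes "x * z < 0"
  shows "sign_var (x # y # z # xs) = sign_var (x # z # xs)"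
  using assms
  by (cases "y = 0"; cases x "0::real" rule: linorder_cases; cases z "0::real" rule: linorder_cases;
      cases y "0::real" rule: linorder_cases)
     (auto simp: sign_var_Cons_Cons mult_less_0_iff)

section \<open>Local behaviour of the sign count\<close>

lemma eventually_poly_same_sign:
  fixes f :: "real poly"
  assumes "poly f x0 \<noteq> 0"
  shows "\<forall>\<^sub>F x in nhds x0. poly f x * poly f x0 > 0"
proof -
  have "((\<lambda>x. poly f x * poly f x0) \<longlongrightarrow> poly f x0 * poly f x0) (nhds x0)"
    by (intro tendsto_intros filterlim_ident)
  moreover have "poly f x0 * poly f x0 > 0"
    using assms by (auto simp: zero_less_mult_iff)
  ultimately show ?thesis
    by (rule order_tendstoD)
qed

text \<open>
  The auxiliary head \<open>s\<close> carries the sign of the preceding remainder, so that a single induction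
  step covers the case where \<open>f\<close> vanishes at \<open>x0\<close> between two remainders of opposite signs.
\<close>

lemma eventually_sign_var_signed_remainders:
  assumes "\<And>x. \<not> (poly f x = 0 \<and> poly g x = 0)"
    and "s \<noteq> 0" "poly f x0 \<noteq> 0 \<or> s * poly g x0 < 0"
  shows "\<forall>\<^sub>F x in nhds x0.
     sign_var (s # map (\<lambda>q. poly q x) (signed_remainders f g)) =
     sign_var (s # map (\<lambda>q. poly q x0) (signed_remainders f g))"
  using assms
proof (induction f g arbitrary: s rule: signed_remainders.induct)
  case (1 f g)
  define V where "V = (\<lambda>f g s x. sign_var (s # map (\<lambda>q. poly q x) (signed_remainders f g)))"
  show ?case
  proof (cases "g = 0")
    case True
    then have f: "poly f x0 \<noteq> 0" using "1.prems"(1)[of x0] by simp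
    show ?thesis
      using eventually_poly_same_sign[OF f]
    proof eventually_elim
      case (elim x)
      then have "sgn (poly f x) = sgn (poly f x0)" "poly f x \<noteq> 0"
        by (auto simp: zero_less_mult_iff)
      then show ?case
        using True f \<open>s \<noteq> 0\<close> by (simp add: signed_remainders.simps sign_var_Cons_Cons)
    qed
  next
    case False
    define h where "h = - (f mod g)"
    have rec: "signed_remainders f g = f # signed_remainders g h"
      using False by (subst signed_remainders.simps) (simp add: h_def)
    \<comment> \<open>This identity drives the induction: a common root of \<open>g\<close> and
      \<open>h\<close> would also be a root of \<open>f\<close>, and at a root of \<open>g\<close>
      the values of \<open>f\<close> and \<open>h\<close> are opposite.\<close>
    have "f = g * (f div g) - h"
      by (simp add: h_def)
    then have fh: "poly f x = poly g x * poly (f div g) x - poly h x" for x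
      by (metis poly_diff poly_mult)
    have IH: "\<forall>\<^sub>F x in nhds x0. V g h t x = V g h t x0"
      if "t \<noteq> 0" "poly g x0 \<noteq> 0 \<or> t * poly h x0 < 0" for t
      unfolding V_def h_def
    proof (rule "1.IH"[OF False _ that(1)])
      show "\<not> (poly g x = 0 \<and> poly (- (f mod g)) x = 0)" for x
        using fh[of x] "1.prems"(1)[of x] unfolding h_def by auto
    qed (use that in \<open>simp add: h_def\<close>)
    show ?thesis
    proof (cases "poly f x0 = 0")
      case False
      \<comment> \<open>If \<open>g\<close> vanishes at \<open>x0\<close>, then \<open>h\<close>
        takes the value \<open>- poly f x0\<close> there, so \<open>poly f x0\<close> qualifies as
        the auxiliary head for the pair \<open>g\<close>, \<open>h\<close>.\<close>
      have "poly g x0 \<noteq> 0 \<or> poly f x0 * poly h x0 < 0"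
        using fh[of x0] False by (auto simp: mult_less_0_iff)
      from IH[OF False this] eventually_poly_same_sign[OF False]
      show ?thesis
      proof eventually_elim
        case (elim x)
        have "poly f x \<noteq> 0" "sgn (poly f x) = sgn (poly f x0)"
          using elim by (auto simp: zero_less_mult_iff)
        \<comment> \<open>The induction hypothesis has its head frozen at \<open>x0\<close>; by
          equality of signs the head may be evaluated at \<open>x\<close> instead.\<close>
        moreover have "V g h (poly f x) x = V g h (poly f x0) x"
          unfolding V_def by (rule sign_var_Cons_pos_mult) (use elim in auto)
        ultimately show ?case
          using elim False \<open>s \<noteq> 0\<close> by (simp add: rec sign_var_Cons_Cons V_def)
      qed
    next
      case True
      then have g: "poly g x0 \<noteq> 0" and sg: "s * poly g x0 < 0"
        using "1.prems" by auto
      obtain L where L: "signed_remainders g h = g # L"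
  by (metis signed_remainders.simps)
      \<comment> \<open>Here \<open>f\<close> stands between \<open>s\<close> and \<open>g\<close>,
        which have opposite signs at and near \<open>x0\<close>. It can be deleted from the list,
        and \<open>s\<close> is passed on as the head for \<open>g\<close>,
        \<open>h\<close>.\<close>
      from IH[OF \<open>s \<noteq> 0\<close> disjI1[OF g]] eventually_poly_same_sign[OF g]
      show ?thesis
      proof eventually_elim
        case (elim x)
        have "s * poly g x < 0"
          using elim(2) sg by (auto simp: mult_less_0_iff zero_less_mult_iff)
        then show ?case
          using elim(1) sg by (simp add: rec L V_def sign_var_insert_between)
      qed
    qed
  qed
qed


text \<open>The auxiliary head is chosen as \<open>poly f x0\<close>: near \<open>x0\<close> it has
  the sign of the next entry and so adds no change.\<close>

lemma eventually_sign_var_signed_remainders_nonzero: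
  assumes "\<And>x. \<not> (poly f x = 0 \<and> poly g x = 0)" and f: "poly f x0 \<noteq> 0"
  shows "\<forall>\<^sub>F x in nhds x0.
     sign_var (map (\<lambda>q. poly q x) (signed_remainders f g)) =
     sign_var (map (\<lambda>q. poly q x0) (signed_remainders f g))"
proof -
  obtain L where L: "signed_remainders f g = f # L"
    by (metis signed_remainders.simps)
  have *: "sign_var (poly f x0 # map (\<lambda>q. poly q x) (f # L)) = sign_var (map (\<lambda>q. poly q x) (f # L))"
    if "poly f x * poly f x0 > 0" for x
  proof -
    have "sgn (poly f x) = sgn (poly f x0)" "poly f x \<noteq> 0"
      using that by (auto simp: zero_less_mult_iff)
    then show ?thesis
      using f by (simp add: sign_var_Cons_Cons)
  qed
  have "poly f x0 * poly f x0 > 0"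
    using f by (auto simp: zero_less_mult_iff)
  note ** = *[OF this]
  from eventually_sign_var_signed_remainders[OF assms(1) f disjI1[OF f]]
    eventually_poly_same_sign[OF f]
  show ?thesis
    unfolding L
  proof eventually_elim
    case (elim x)
    then show ?case
      using *[of x] ** by simp
  qed
qed

text \<open>At a root \<open>x0\<close>, write \<open>p = [:-x0, 1:] * q\<close>; the product rule
  gives \<open>q\<close> and \<open>p'\<close> the same value at \<open>x0\<close>. Near
  \<open>x0\<close> the signs of \<open>p\<close> and \<open>p'\<close> therefore differ on the left
  and agree on the right, while at \<open>x0\<close> the zero head is dropped. The tail starting at
  \<open>p'\<close> keeps its count, since \<open>p'\<close> does not vanish at
  \<open>x0\<close>.\<close>

lemma eventually_sign_var_sturm_sequence:
  fixes p :: "real poly"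
  assumes sqf: "\<And>x. \<not> (poly p x = 0 \<and> poly (pderiv p) x = 0)"
  shows "\<forall>\<^sub>F x in nhds x0.
     sign_var (map (\<lambda>q. poly q x) (sturm_sequence p)) =
       sign_var (map (\<lambda>q. poly q x0) (sturm_sequence p)) +
         (if x < x0 \<and> poly p x0 = 0 then 1 else 0) \<and>
     (x \<noteq> x0 \<longrightarrow> poly p x \<noteq> 0)"
proof (cases "poly p x0 = 0")
  case False
  from eventually_sign_var_signed_remainders_nonzero[OF sqf False] eventually_poly_same_sign[OF False]
  show ?thesis
    unfolding sturm_sequence_def by eventually_elim (use False in auto)
next
  case True
  define g h where "g = pderiv p" and "h = - (p mod pderiv p)"
  have g: "poly g x0 \<noteq> 0"
    using sqf True by (auto simp: g_def)
  then have rec: "sturm_sequence p = p # signed_remainders g h"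
    unfolding sturm_sequence_def by (subst signed_remainders.simps) (auto simp: g_def h_def)
  obtain q where q: "p = [:-x0, 1:] * q"
    using True by (auto simp: poly_eq_0_iff_dvd)
  have qx0: "poly q x0 = poly g x0"
    by (simp only: g_def q pderiv_mult) (simp add: pderiv_pCons)
  have gh: "\<not> (poly g x = 0 \<and> poly h x = 0)" for x
  proof -
    have "p = g * (p div g) - h"
      by (simp add: g_def h_def)
    then have "poly p x = poly g x * poly (p div g) x - poly h x"
      by (metis poly_diff poly_mult)
    then show ?thesis
      using sqf[of x] by (auto simp: g_def)
  qed
  obtain L where L: "signed_remainders g h = g # L"
    by (metis signed_remainders.simps)
  from eventually_sign_var_signed_remainders_nonzero[OF gh g] eventually_poly_same_sign[OF g]
    eventually_poly_same_sign[of q x0, unfolded qx0, OF g]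
  show ?thesis
  proof eventually_elim
    case (elim x)
    have p: "poly p x = (x - x0) * poly q x"
      by (simp add: q algebra_simps)
    have qx: "sgn (poly q x) = sgn (poly g x)" "poly q x \<noteq> 0" "poly g x \<noteq> 0"
      using elim by (auto simp: zero_less_mult_iff)
    then have sgnp: "sgn (poly p x) = sgn (x - x0) * sgn (poly g x)"
      by (simp add: p sgn_mult)
    consider "x = x0" | "x < x0" | "x0 < x"
      by linarith
    then show ?case
    proof cases
      case 2
      then have "sgn (poly p x) \<noteq> sgn (poly g x)" "poly p x \<noteq> 0"
        using sgnp qx by (auto simp: p sgn_zero_iff)
      then show ?thesis
        using elim(1) qx 2 True by (simp add: rec L sign_var_Cons_Cons)
    next
      case 3
      then have "sgn (poly p x) = sgn (poly g x)" "poly p x \<noteq> 0"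
        using sgnp qx by (auto simp: p)
      then show ?thesis
        using elim(1) qx 3 True by (simp add: rec L sign_var_Cons_Cons)
    qed (use True in \<open>simp add: rec\<close>)
  qed
qed

text \<open>The count has already dropped at the root itself, hence the interval open on the left
  and closed on the right; the endpoints may be roots. Both sides are additive over adjacent
  intervals, so \<open>Bolzano\<close> leaves only short intervals around a point.\<close>

theorem sturm_interval:
  fixes p :: "real poly"
  assumes sqf: "\<And>x. \<not> (poly p x = 0 \<and> poly (pderiv p) x = 0)" and "a \<le> b"
  shows "sign_var (map (\<lambda>q. poly q a) (sturm_sequence p)) =
     sign_var (map (\<lambda>q. poly q b) (sturm_sequence p)) + card {x. a < x \<and> x \<le> b \<and> poly p x = 0}"
    (is "?V a = ?V b + card (?R a b)")
  using \<open>a \<le> b\<close>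
proof (induction rule: Bolzano)
  case (trans a b c)
  have "p \<noteq> 0"
    using sqf by auto
  then have fin: "finite (?R a b)" for a b
    by (rule rev_finite_subset[OF poly_roots_finite]) auto
  have "?R a c = ?R a b \<union> ?R b c"
    using trans(3,4) by auto
  moreover have "?R a b \<inter> ?R b c = {}"
    by auto
  ultimately have card: "card (?R a c) = card (?R a b) + card (?R b c)"
    by (simp only: card_Un_disjoint[OF fin fin])
  show ?case
    by (simp only: card trans(1,2) add_ac)
next
  case (local x0)
  obtain d where "d > 0" and d: "\<And>x. dist x x0 < d \<Longrightarrow>
      ?V x = ?V x0 + (if x < x0 \<and> poly p x0 = 0 then 1 else 0) \<and> (x \<noteq> x0 \<longrightarrow> poly p x \<noteq> 0)"
    using eventually_sign_var_sturm_sequence[OF sqf, of x0] unfolding eventually_nhds_metric by blast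
  have "?V a = ?V b + card (?R a b)" if ab: "a \<le> x0" "x0 \<le> b" "b - a < d" for a b
  proof -
    have "dist a x0 < d" "dist b x0 < d"
      using ab by (simp_all add: dist_real_def)
    note Va = conjunct1[OF d[OF this(1)]] and Vb = conjunct1[OF d[OF this(2)]]
    have *: "x = x0" if "a < x" "x \<le> b" "poly p x = 0" for x
    proof -
      have "dist x x0 < d"
        using ab that by (simp add: dist_real_def)
      from d[OF this] that(3) show ?thesis
        by metis
    qed
    \<comment> \<open>The only possible root in the short interval is \<open>x0\<close>, and it is
      counted unless it is the excluded endpoint \<open>a\<close>.\<close>
    have "a < x \<and> x \<le> b \<and> poly p x = 0 \<longleftrightarrow> x = x0 \<and> a < x0 \<and> poly p x0 = 0" for x
      using *[of x] ab(2) by blast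
    then have "?R a b = (if a < x0 \<and> poly p x0 = 0 then {x0} else {})"
      by simp
    then show ?thesis
      unfolding Va Vb using ab by simp
  qed
  with \<open>d > 0\<close> show ?case
    by (intro exI[of _ d]) simp
qed

section \<open>Signs near plus and minus infinity\<close>

lemma eventually_sgn_poly_at_top:
  fixes q :: "real poly"
  shows "\<forall>\<^sub>F x in at_top. sgn (poly q x) = sgn (lead_coeff q)"
proof -
  have pos: "\<forall>\<^sub>F x in at_top. poly q x > 0" if "lead_coeff q > 0" for q :: "real poly"
    using poly_pinfty_gt_lc[OF that] that
    unfolding eventually_at_top_linorder by (meson less_le_trans)
  consider "lead_coeff q = 0" | "lead_coeff q > 0" | "lead_coeff q < 0"
    by linarith
  then show ?thesis
  proof cases
    case 2
    from pos[OF 2] show ?thesis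
      by eventually_elim (use 2 in auto)
  next
    case 3
    then have "lead_coeff (- q) > 0"
      by simp
    from pos[OF this] show ?thesis
      by eventually_elim (use 3 in auto)
  qed simp
qed

lemma eventually_sign_var_at_top:
  fixes qs :: "real poly list"
  shows "\<forall>\<^sub>F x in at_top. sign_var (map (\<lambda>q. poly q x) qs) = sign_var (map lead_coeff qs)"
proof -
  have "\<forall>\<^sub>F x in at_top. \<forall>q\<in>set qs. sgn (poly q x) = sgn (lead_coeff q)"
    by (simp add: eventually_ball_finite_distrib eventually_sgn_poly_at_top)
  then show ?thesis
  proof eventually_elim
    case (elim x)
    then have "map sgn (map (\<lambda>q. poly q x) qs) = map sgn (map lead_coeff qs)"
      by simp
    then show ?case
      by (metis sign_var_map_sgn)
  qed
qed

lemma eventually_sign_var_at_bot: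
  fixes qs :: "real poly list"
  shows "\<forall>\<^sub>F x in at_bot. sign_var (map (\<lambda>q. poly q x) qs) =
    sign_var (map (\<lambda>q. (-1) ^ degree q * lead_coeff q) qs)"
proof -
  \<comment> \<open>Reflecting the variable reduces minus infinity to plus infinity; the leading
    coefficient picks up the factor \<open>(-1) ^ degree q\<close>.\<close>
  define r where "r = (\<lambda>q :: real poly. q \<circ>\<^sub>p [:0, -1:])"
  have "lead_coeff (r q) = (-1) ^ degree q * lead_coeff q" for q
    by (simp add: r_def lead_coeff_comp)
  moreover have "poly (r q) (- x) = poly q x" for q x
    by (simp add: r_def poly_pcompose)
  moreover have "\<forall>\<^sub>F x in at_bot. sign_var (map (\<lambda>q. poly q (- x)) (map r qs)) = sign_var (map lead_coeff (map r qs))"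
    using eventually_sign_var_at_top[of "map r qs"] unfolding at_top_mirror eventually_filtermap by simp
  ultimately show ?thesis
    by (simp add: o_def)
qed

text \<open>The interval version is applied to \<open>(0, u]\<close> and \<open>(l, 0]\<close>, with
  \<open>u\<close> and \<open>l\<close> beyond all roots and far enough out for the counts to be
  those of the leading terms. The second interval contains 0, hence the non-strict
  inequality.\<close>

lemma sturm_sequence_sign_var:
  fixes p :: "real poly"
  assumes sqf: "\<And>x. \<not> (poly p x = 0 \<and> poly (pderiv p) x = 0)"
  shows "int (card {x. x > 0 \<and> poly p x = 0}) =
      int (sign_var (map (\<lambda>q. coeff q 0) (sturm_sequence p))) -
      int (sign_var (map lead_coeff (sturm_sequence p)))"
    and "int (card {x. x \<le> 0 \<and> poly p x = 0}) =
      int (sign_var (map (\<lambda>q. (-1) ^ degree q * lead_coeff q) (sturm_sequence p))) -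
      int (sign_var (map (\<lambda>q. coeff q 0) (sturm_sequence p)))"
proof -
  define R where "R = {x. poly p x = 0}"
  have "p \<noteq> 0"
    using sqf by auto
  then have fin: "finite R"
    unfolding R_def by (rule poly_roots_finite)
  have "\<forall>\<^sub>F x in at_top. \<forall>y\<in>R. y \<le> x" "\<forall>\<^sub>F x in at_bot. \<forall>y\<in>R. x < y"
    using fin by (simp_all add: eventually_ball_finite_distrib eventually_ge_at_top eventually_gt_at_bot)
  then have top: "\<forall>\<^sub>F x in at_top. (\<forall>y\<in>R. y \<le> x) \<and> 0 \<le> x \<and>
      sign_var (map (\<lambda>q. poly q x) (sturm_sequence p)) = sign_var (map lead_coeff (sturm_sequence p))"
      and bot: "\<forall>\<^sub>F x in at_bot. (\<forall>y\<in>R. x < y) \<and> x \<le> 0 \<and>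
      sign_var (map (\<lambda>q. poly q x) (sturm_sequence p)) =
        sign_var (map (\<lambda>q. (-1) ^ degree q * lead_coeff q) (sturm_sequence p))"
    by - (intro eventually_conj eventually_ge_at_top eventually_le_at_bot
        eventually_sign_var_at_top eventually_sign_var_at_bot; assumption)+
  from eventually_happens'[OF trivial_limit_at_top_linorder top] obtain u where
      u: "\<forall>y\<in>R. y \<le> u" "0 \<le> u"
        "sign_var (map (\<lambda>q. poly q u) (sturm_sequence p)) = sign_var (map lead_coeff (sturm_sequence p))"
    by blast
  from eventually_happens'[OF trivial_limit_at_bot_linorder bot] obtain l where
      l: "\<forall>y\<in>R. l < y" "l \<le> 0"
        "sign_var (map (\<lambda>q. poly q l) (sturm_sequence p)) =
          sign_var (map (\<lambda>q. (-1) ^ degree q * lead_coeff q) (sturm_sequence p))"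
    by blast
  have "{x. 0 < x \<and> x \<le> u \<and> poly p x = 0} = {x. x > 0 \<and> poly p x = 0}"
    and "{x. l < x \<and> x \<le> 0 \<and> poly p x = 0} = {x. x \<le> 0 \<and> poly p x = 0}"
    using u(1) l(1) by (auto simp: R_def)
  then show "int (card {x. x > 0 \<and> poly p x = 0}) =
      int (sign_var (map (\<lambda>q. coeff q 0) (sturm_sequence p))) -
      int (sign_var (map lead_coeff (sturm_sequence p)))"
    and "int (card {x. x \<le> 0 \<and> poly p x = 0}) =
      int (sign_var (map (\<lambda>q. (-1) ^ degree q * lead_coeff q) (sturm_sequence p))) -
      int (sign_var (map (\<lambda>q. coeff q 0) (sturm_sequence p)))"
    using sturm_interval[OF sqf u(2)] sturm_interval[OF sqf l(2)] u(3) l(3)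
    by (simp_all add: poly_0_coeff_0)
qed

section \<open>The characteristic polynomial\<close>

lemma map_poly_of_real_add:
  "map_poly of_real (p + q) = (map_poly of_real p + map_poly of_real q :: 'a::real_algebra_1 poly)"
  by (simp add: poly_eq_iff coeff_map_poly)

lemma map_poly_of_real_mult:
  "map_poly of_real (p * q) = (map_poly of_real p * map_poly of_real q :: 'a::{real_algebra_1,comm_ring_1} poly)"
  by (simp add: poly_eq_iff coeff_map_poly coeff_mult)

text \<open>The Leibniz formula consists of sums, products and signs, all of which \<open>h\<close>
  preserves.\<close>

lemma det_ring_hom:
  fixes M :: "'b::comm_ring_1^'m::finite^'m" and h :: "'b \<Rightarrow> 'c::comm_ring_1"
  assumes "\<And>x y. h (x + y) = h x + h y" "\<And>x y. h (x * y) = h x * h y" "h 0 = 0" "h 1 = 1"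
  shows "h (det M) = det (\<chi> i j. h (M $ i $ j))"
proof -
  have sum: "h (sum f S) = (\<Sum>x\<in>S. h (f x))" for f :: "('m \<Rightarrow> 'm) \<Rightarrow> 'b" and S
    by (induction S rule: infinite_finite_induct) (use assms in auto)
  have prod: "h (prod f S) = (\<Prod>x\<in>S. h (f x))" for f :: "'m \<Rightarrow> 'b" and S
    by (induction S rule: infinite_finite_induct) (use assms in auto)
  have "h (- 1) = - 1"
    using assms(1)[of 1 "- 1"] assms(3,4) by (simp add: eq_neg_iff_add_eq_0 add.commute)
  then have "h (of_int (sign \<pi>)) = of_int (sign \<pi>)" for \<pi> :: "'m \<Rightarrow> 'm"
    using assms(4) by (simp add: sign_def)
  then show ?thesis
    by (simp add: det_def sum prod assms(2))
qed

text \<open>Embedding the coefficients into the complex numbers and evaluating at \<open>l\<close>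
  is a ring homomorphism, so it can be moved inside the determinant.\<close>

lemma poly_characteristic_poly:
  "poly (complex_poly (characteristic_poly J)) l = det (map_matrix complex_of_real J - mat l)"
proof -
  have "poly (complex_poly (characteristic_poly J)) l =
    det (\<chi> i j. poly (complex_poly ((map_matrix (\<lambda>a. [:a:]) J - mat [:0, 1:]) $ i $ j)) l)"
    unfolding characteristic_poly_def
    by (rule det_ring_hom) (simp_all add: map_poly_of_real_add map_poly_of_real_mult)
  also have "(\<chi> i j. poly (complex_poly ((map_matrix (\<lambda>a. [:a:]) J - mat [:0, 1:]) $ i $ j)) l) =
    map_matrix complex_of_real J - mat l"
    by (simp add: vec_eq_iff mat_def map_poly_pCons)
  finally show ?thesis .
qed

text \<open>An eigenvector is a non-zero kernel vector of \<open>?A - mat l\<close>, which exists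
  exactly when this matrix is singular.\<close>

lemma eigenvalue_iff_root:
  fixes J :: "real^'m::finite^'m"
  shows "eigenvalue J l \<longleftrightarrow> poly (complex_poly (characteristic_poly J)) l = 0"
proof -
  let ?A = "map_matrix complex_of_real J"
  have "mat l *v v = l *s v" for v :: "complex^'m"
    by (simp add: mat_def vec_eq_iff matrix_vector_mult_def if_distrib[of "\<lambda>x. x * _"] cong: if_cong)
  then have "(?A - mat l) *v v = ?A *v v - l *s v" for v
    by (simp add: matrix_vector_mult_diff_rdistrib)
  then have "eigenvalue J l \<longleftrightarrow> \<not> (\<forall>v. (?A - mat l) *v v = 0 \<longrightarrow> v = 0)"
    by (auto simp: eigenvalue_def)
  also have "\<dots> \<longleftrightarrow> det (?A - mat l) = 0"
    unfolding matrix_left_invertible_ker[symmetric] invertible_left_inverse[symmetric] invertible_det_nz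
    by simp
  finally show ?thesis
    by (simp add: poly_characteristic_poly)
qed

text \<open>In the Leibniz expansion only the identity permutation reaches full degree: any other
  one uses an off-diagonal entry, which is constant.\<close>

lemma degree_characteristic_poly:
  fixes J :: "real^'m::finite^'m"
  shows "degree (characteristic_poly J) = CARD('m)"
proof -
  define M where "M = map_matrix (\<lambda>a. [:a:]) J - mat [:0, 1:]"
  define t where "t = (\<lambda>\<pi>. of_int (sign \<pi>) * (\<Prod>i\<in>UNIV. M $ i $ \<pi> i))"
  let ?P = "{\<pi>. \<pi> permutes (UNIV :: 'm set)}"
  have diag: "M $ i $ i = [:J $ i $ i, -1:]" and off: "i \<noteq> j \<Longrightarrow> M $ i $ j = [:J $ i $ j:]" for i j
    by (simp_all add: M_def mat_def)
  have "finite ?P"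
    by (simp add: finite_permutations)
  then have "characteristic_poly J = t id + (\<Sum>\<pi>\<in>?P - {id}. t \<pi>)"
    unfolding characteristic_poly_def M_def[symmetric] det_def t_def[symmetric]
    by (intro sum.remove) (auto simp: permutes_id)
  moreover have id: "degree (t id) = CARD('m)"
    by (simp add: t_def diag degree_prod_eq_sum_degree)
  moreover have "degree (\<Sum>\<pi>\<in>?P - {id}. t \<pi>) < CARD('m)"
  proof (rule degree_sum_less)
    fix \<pi> assume "\<pi> \<in> ?P - {id}"
    then obtain k where k: "\<pi> k \<noteq> k"
      by (auto simp: fun_eq_iff)
    have "degree (t \<pi>) \<le> degree (\<Prod>i\<in>UNIV. M $ i $ \<pi> i)"
      by (simp add: t_def sign_def)
    also have "\<dots> \<le> (\<Sum>i\<in>UNIV. degree (M $ i $ \<pi> i))"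
      using degree_prod_sum_le[of UNIV "\<lambda>i. M $ i $ \<pi> i"] by (simp add: o_def)
    also have "\<dots> < (\<Sum>i\<in>(UNIV :: 'm set). 1)"
    proof (rule sum_strict_mono_ex1)
      show "\<forall>i\<in>UNIV. degree (M $ i $ \<pi> i) \<le> 1"
        by (metis One_nat_def diag off degree_pCons_le degree_pCons_0 le_SucI le_zero_eq zero_le le_trans)
      show "\<exists>i\<in>UNIV. degree (M $ i $ \<pi> i) < 1"
        using k by (intro bexI[of _ k]) (auto simp: off)
    qed simp
    finally show "degree (t \<pi>) < CARD('m)"
      by simp
  qed simp
  ultimately show ?thesis
    by (simp add: degree_add_eq_left)
qed

section \<open>The winding number along the imaginary axis\<close>

text \<open>Up to the factor \<open>- sgn (Re z)\<close> the integrand is the Poisson kernel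
  \<open>x / (x\<^sup>2 + (s - y)\<^sup>2)\<close>, with antiderivative
  \<open>arctan ((s - y) / x)\<close> running from \<open>- pi / 2\<close> to
  \<open>pi / 2\<close>.\<close>

lemma has_integral_Re_inverse_line:
  fixes z :: complex
  assumes "Re z \<noteq> 0"
  shows "((\<lambda>s. Re (1 / (\<i> * of_real s - z))) has_integral - sgn (Re z) * pi) UNIV"
proof -
  define x y where "x = \<bar>Re z\<bar>" and "y = Im z"
  have "x > 0"
    using assms by (simp add: x_def)
  define f where "f = (\<lambda>s. x / (x\<^sup>2 + (s - y)\<^sup>2))"
  define F where "F = (\<lambda>s. arctan ((s - y) / x))"
  have pos: "x\<^sup>2 + (s - y)\<^sup>2 > 0" for s
    using \<open>x > 0\<close> by (simp add: add_pos_nonneg)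
  have deriv: "DERIV F s :> f s" for s
    unfolding F_def f_def using \<open>x > 0\<close> pos[of s]
    by (auto intro!: derivative_eq_intros simp: power_divide divide_simps power2_eq_square)
  have cont: "isCont f s" for s
    unfolding f_def using pos[of s] by (intro continuous_intros) auto
  have lim: "((F \<circ> real_of_ereal) \<longlongrightarrow> - (pi / 2)) (at_right (- \<infinity>))"
    "((F \<circ> real_of_ereal) \<longlongrightarrow> pi / 2) (at_left \<infinity>)"
    unfolding ereal_tendsto_simps F_def
    using \<open>x > 0\<close> by real_asymp+
  have nn: "0 \<le> f s" for s
    using pos[of s] \<open>x > 0\<close> by (simp add: f_def)
  \<comment> \<open>Since \<open>f\<close> is non-negative, the limits of \<open>F\<close> at both
    ends yield integrability over the whole line as well as the value.\<close>
  note FTC = interval_integral_FTC_nonneg[of "- \<infinity>" \<infinity> F f, OF _ deriv cont _ lim]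
  have "set_integrable lborel UNIV f" and "(LBINT s:UNIV. f s) = pi"
    using FTC nn by (simp_all add: interval_lebesgue_integral_def)
  then have "integrable lborel f" and "integral\<^sup>L lborel f = pi"
    by (simp_all add: set_integrable_def set_lebesgue_integral_def)
  then have "(f has_integral pi) UNIV"
    using has_integral_integral_lborel by metis
  then have "((\<lambda>s. - sgn (Re z) * f s) has_integral - sgn (Re z) * pi) UNIV"
    by (rule has_integral_mult_right)
  moreover have "Re (1 / (\<i> * of_real s - z)) = - sgn (Re z) * f s" for s
    using assms by (simp add: Re_divide f_def x_def y_def sgn_if)
  ultimately show ?thesis
    by simp
qed

section \<open>Logarithmic derivatives\<close>

lemma logderiv_prod_mset:
  fixes w :: complex
  assumes "w \<notin># M"
  shows "poly (pderiv (\<Prod>x\<in>#M. [:-x, 1:])) w / poly (\<Prod>x\<in>#M. [:-x, 1:]) w = (\<Sum>x\<in>#M. 1 / (w - x))"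
  using assms
proof (induction M)
  case (add x M)
  have "poly (\<Prod>x\<in>#M. [:-x, 1:]) w \<noteq> 0"
    using add.prems by (auto simp: poly_prod_mset)
  then have "poly (pderiv (\<Prod>x\<in>#add_mset x M. [:-x, 1:])) w / poly (\<Prod>x\<in>#add_mset x M. [:-x, 1:]) w =
    1 / (w - x) + poly (pderiv (\<Prod>x\<in>#M. [:-x, 1:])) w / poly (\<Prod>x\<in>#M. [:-x, 1:]) w"
    using add.prems by (simp add: pderiv_mult pderiv_pCons field_simps del: mult_pCons_left)
  with add show ?case by simp
qed simp

text \<open>A complex polynomial splits into linear factors, and the leading coefficient cancels in
  the quotient.\<close>

lemma logderiv_complex_poly:
  fixes P :: "complex poly"
  assumes "poly P w \<noteq> 0"
  shows "poly (pderiv P) w / poly P w = (\<Sum>x\<in>#proots P. 1 / (w - x))"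
proof -
  let ?Q = "\<Prod>x\<in>#proots P. [:-x, 1:]"
  have "P \<noteq> 0"
    using assms by auto
  have "P = smult (lead_coeff P) ?Q"
    by (simp add: complex_poly_decompose_multiset)
  then have "poly P w = lead_coeff P * poly ?Q w" "poly (pderiv P) w = lead_coeff P * poly (pderiv ?Q) w"
    by (metis poly_smult, metis poly_smult pderiv_smult)
  then have "poly (pderiv P) w / poly P w = poly (pderiv ?Q) w / poly ?Q w"
    using \<open>P \<noteq> 0\<close> by simp
  then show ?thesis
    using assms \<open>P \<noteq> 0\<close> by (subst logderiv_prod_mset[symmetric]) auto
qed

lemma has_integral_Re_logderiv:
  fixes P :: "complex poly"
  assumes "P \<noteq> 0" and hyp: "\<And>z. poly P z = 0 \<Longrightarrow> Re z \<noteq> 0"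
  shows "((\<lambda>s. Re (poly (pderiv P) (\<i> * of_real s) / poly P (\<i> * of_real s))) has_integral
    - pi * (\<Sum>z\<in>#proots P. sgn (Re z))) UNIV"
proof -
  \<comment> \<open>Stated for an arbitrary multiset off the imaginary axis, so that the induction
    adds one root at a time.\<close>
  have "((\<lambda>s. Re (\<Sum>z\<in>#M. 1 / (\<i> * of_real s - z))) has_integral - pi * (\<Sum>z\<in>#M. sgn (Re z))) UNIV"
    if "\<forall>z\<in>#M. Re z \<noteq> 0" for M
    using that
  proof (induction M)
    case (add z M)
    have "((\<lambda>s. Re (1 / (\<i> * of_real s - z)) + Re (\<Sum>z\<in>#M. 1 / (\<i> * of_real s - z))) has_integral
      - sgn (Re z) * pi + - pi * (\<Sum>z\<in>#M. sgn (Re z))) UNIV"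
      using add by (intro has_integral_add has_integral_Re_inverse_line) auto
    then show ?case
      by (simp add: algebra_simps)
  qed simp
  from this[of "proots P"] have "((\<lambda>s. Re (\<Sum>z\<in>#proots P. 1 / (\<i> * of_real s - z))) has_integral
      - pi * (\<Sum>z\<in>#proots P. sgn (Re z))) UNIV"
    using assms by simp
  moreover have "poly P (\<i> * of_real s) \<noteq> 0" for s
    using hyp by force
  ultimately show ?thesis
    by (simp add: logderiv_complex_poly)
qed

text \<open>Write \<open>p (\<i> s) = f + \<i> g\<close>. Differentiating in \<open>s\<close> gives
  \<open>p' (\<i> s) = g' - \<i> f'\<close>, so the real part of \<open>p' / p\<close> is
  \<open>(g' f - f' g) / (f\<^sup>2 + g\<^sup>2)\<close>, the integrand of
  \<open>wind\<close>.\<close>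

lemma wind_re_im_part:
  fixes p :: "real poly"
  assumes "p \<noteq> 0" and hyp: "\<And>z. poly (complex_poly p) z = 0 \<Longrightarrow> Re z \<noteq> 0"
  shows "wind (re_part p) (im_part p) = - (\<Sum>z\<in>#proots (complex_poly p). sgn (Re z)) / 2"
proof -
  define P where "P = complex_poly p"
  define Q where "Q = pcompose P [:0, \<i>:]"
  have integrand: "(poly (pderiv (im_part p)) s * poly (re_part p) s - poly (pderiv (re_part p)) s * poly (im_part p) s)
      / ((poly (re_part p) s)\<^sup>2 + (poly (im_part p) s)\<^sup>2) =
    Re (poly (pderiv P) (\<i> * of_real s) / poly P (\<i> * of_real s))" for s
  proof -
    have "poly P (\<i> * of_real s) = Complex (poly (re_part p) s) (poly (im_part p) s)"
      unfolding P_def by (simp add: poly_imaginary_axis complex_eq_iff)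
    moreover have "pderiv (re_part p) = map_poly Re (pderiv Q)" "pderiv (im_part p) = map_poly Im (pderiv Q)"
      by (simp_all add: poly_eq_iff coeff_pderiv coeff_map_poly re_part_def im_part_def Q_def P_def)
    then have "Complex (poly (pderiv (re_part p)) s) (poly (pderiv (im_part p)) s) = poly (pderiv Q) (of_real s)"
      by (simp add: poly_re_im_of_real)
    then have "\<i> * poly (pderiv P) (\<i> * of_real s) =
        Complex (poly (pderiv (re_part p)) s) (poly (pderiv (im_part p)) s)"
      by (simp add: Q_def pderiv_pcompose pderiv_pCons poly_pcompose mult.commute)
    then have "poly (pderiv P) (\<i> * of_real s) =
        Complex (poly (pderiv (im_part p)) s) (- poly (pderiv (re_part p)) s)"
      by (auto simp: complex_eq_iff)
    ultimately show ?thesis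
      by (simp add: Re_divide)
  qed
  have "P \<noteq> 0"
    using \<open>p \<noteq> 0\<close> by (simp add: P_def map_poly_eq_0_iff)
  from has_integral_Re_logderiv[OF this] hyp
  have "integral UNIV (\<lambda>s. Re (poly (pderiv P) (\<i> * of_real s) / poly P (\<i> * of_real s))) =
    - pi * (\<Sum>z\<in>#proots P. sgn (Re z))"
    by (intro integral_unique) (simp add: P_def)
  then show ?thesis
    unfolding wind_def integrand by (simp add: P_def)
qed

section \<open>Counting roots by half plane\<close>

lemma poly_map_poly_of_real:
  "poly (map_poly of_real p) (of_real x) = (of_real (poly p x) :: 'a::{real_algebra_1,comm_ring_1})"
  by (induction p) (simp_all add: map_poly_pCons)

lemma map_poly_cnj_mult: "map_poly cnj (p * q) = map_poly cnj p * map_poly cnj q"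
  by (simp add: poly_eq_iff coeff_map_poly coeff_mult)

lemma map_poly_cnj_power: "map_poly cnj (p ^ n) = map_poly cnj p ^ n"
  by (induction n) (simp_all add: map_poly_cnj_mult)

text \<open>Conjugating coefficients fixes a polynomial with real coefficients and turns its factor
  \<open>[:-a, 1:] ^ n\<close> into \<open>[:-cnj a, 1:] ^ n\<close>; the conjugated cofactor does
  not vanish at \<open>cnj a\<close>.\<close>

lemma order_cnj_complex_poly:
  assumes "p \<noteq> 0"
  shows "order (cnj a) (complex_poly p) = order a (complex_poly p)"
proof -
  define P where "P = complex_poly p"
  have "P \<noteq> 0"
    using assms by (simp add: P_def map_poly_eq_0_iff)
  then obtain q where q: "P = [:-a, 1:] ^ order a P * q" "\<not> [:-a, 1:] dvd q"
    using order_decomp by blast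
  have "map_poly cnj P = P"
    by (simp add: P_def poly_eq_iff coeff_map_poly)
  then have "P = [:-cnj a, 1:] ^ order a P * map_poly cnj q"
    using arg_cong[OF q(1), of "map_poly cnj"] by (simp add: map_poly_cnj_mult map_poly_cnj_power map_poly_pCons)
  moreover have "poly (map_poly cnj q) (cnj a) \<noteq> 0"
    using q(2) by (simp add: poly_eq_0_iff_dvd)
  ultimately have "order (cnj a) P = order a P"
    using \<open>P \<noteq> 0\<close> by (metis order_mult order_power_n_n order_0I add.right_neutral)
  then show ?thesis
    by (simp add: P_def)
qed

lemma size_filter_proots:
  assumes "P \<noteq> 0"
  shows "size {#z \<in># proots P. C z#} = (\<Sum>z | poly P z = 0 \<and> C z. order z P)"
  using assms by (auto simp: size_multiset_overloaded_eq intro!: sum.cong)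

lemma sum_mset_sgn_Re:
  assumes "\<forall>z\<in>#M. Re z \<noteq> 0"
  shows "(\<Sum>z\<in>#M. sgn (Re z)) = real (size {#z \<in># M. Re z > 0#}) - real (size {#z \<in># M. Re z < 0#})"
    and "size M = size {#z \<in># M. Re z > 0#} + size {#z \<in># M. Re z < 0#}"
  using assms by (induction M) (auto simp: sgn_if)

text \<open>The roots are split by the sign of \<open>Im z\<close>; conjugation exchanges the upper
  and lower ones and preserves real part and order. The predicate \<open>C\<close> lets one
  statement serve both half planes.\<close>

lemma size_filter_proots_conj_pairs:
  fixes p :: "real poly" and C :: "real \<Rightarrow> bool"
  assumes "p \<noteq> 0"
  defines "P \<equiv> complex_poly p"
  shows "size {#z \<in># proots P. C (Re z)#} =
    2 * (\<Sum>z | poly P z = 0 \<and> Im z > 0 \<and> C (Re z). order z P) +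
    (\<Sum>z | poly P z = 0 \<and> Im z = 0 \<and> C (Re z). order z P)"
proof -
  have "P \<noteq> 0"
    using assms by (simp add: map_poly_eq_0_iff)
  let ?S = "\<lambda>D. \<Sum>z | poly P z = 0 \<and> D (Im z) \<and> C (Re z). order z P"
  have root_cnj: "poly P (cnj z) = 0 \<longleftrightarrow> poly P z = 0" for z
    using order_cnj_complex_poly[OF \<open>p \<noteq> 0\<close>, of z] \<open>P \<noteq> 0\<close> by (simp add: P_def order_root)
  have "?S (\<lambda>y. y < 0) = ?S (\<lambda>y. y > 0)"
    by (rule sum.reindex_bij_witness[of _ cnj cnj])
      (auto simp: root_cnj, simp_all add: P_def order_cnj_complex_poly[OF \<open>p \<noteq> 0\<close>])
  moreover have "size {#z \<in># proots P. C (Re z)#} = ?S (\<lambda>y. y > 0) + ?S (\<lambda>y. y < 0) + ?S (\<lambda>y. y = 0)"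
  proof -
    have "size {#z \<in># M. C (Re z)#} = size {#z \<in># M. Im z > 0 \<and> C (Re z)#} +
        size {#z \<in># M. Im z < 0 \<and> C (Re z)#} + size {#z \<in># M. Im z = 0 \<and> C (Re z)#}" for M
      by (induction M) auto
    then show ?thesis
      using \<open>P \<noteq> 0\<close> by (simp add: size_filter_proots)
  qed
  ultimately show ?thesis
    by simp
qed

text \<open>With all orders equal to 1 the multiplicity count is a plain cardinality, which is what
  Sturm's theorem computes.\<close>

lemma sum_order_real_roots_rsquarefree:
  fixes p :: "real poly"
  assumes "rsquarefree (complex_poly p)"
  shows "(\<Sum>z | poly (complex_poly p) z = 0 \<and> Im z = 0 \<and> C (Re z). order z (complex_poly p)) =
    card {x. C x \<and> poly p x = 0}"
proof -
  have "{z. poly (complex_poly p) z = 0 \<and> Im z = 0 \<and> C (Re z)} = of_real ` {x. C x \<and> poly p x = 0}"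
  proof (intro set_eqI iffI)
    fix z assume "z \<in> {z. poly (complex_poly p) z = 0 \<and> Im z = 0 \<and> C (Re z)}"
    moreover from this have "z = of_real (Re z)"
      by (simp add: complex_eq_iff)
    ultimately show "z \<in> of_real ` {x. C x \<and> poly p x = 0}"
      by (metis (mono_tags, lifting) imageI mem_Collect_eq of_real_eq_0_iff poly_map_poly_of_real)
  qed (auto simp: poly_map_poly_of_real)
  moreover have "order z (complex_poly p) = 1" if "poly (complex_poly p) z = 0" for z
    using assms that by (intro rsquarefree_root_order) (auto simp: rsquarefree_def)
  then have "(\<Sum>z | poly (complex_poly p) z = 0 \<and> Im z = 0 \<and> C (Re z). order z (complex_poly p)) =
      card {z. poly (complex_poly p) z = 0 \<and> Im z = 0 \<and> C (Re z)}"
    by simp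
  ultimately show ?thesis
    by (simp add: card_image inj_on_def)
qed

text \<open>Simplicity of all complex roots, restricted to real points, is the hypothesis on which
  the Sturm argument runs.\<close>

lemma rsquarefree_complex_poly_imp_no_common_root:
  assumes "rsquarefree (complex_poly p)"
  shows "\<not> (poly p x = 0 \<and> poly (pderiv p) x = 0)"
proof -
  have "pderiv (complex_poly p) = complex_poly (pderiv p)"
    by (simp add: poly_eq_iff coeff_pderiv coeff_map_poly)
  then show ?thesis
    using assms[unfolded rsquarefree_roots, rule_format, of "of_real x"]
    by (simp add: poly_map_poly_of_real)
qed

section \<open>Spectral indices of a hyperbolic equilibrium\<close>

theorem theorem4:
  fixes T :: "'a topology" and A :: "('a, 'm::finite) chart set"
    and X :: "('a, 'm) chart \<Rightarrow> 'a \<Rightarrow> real^'m"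
    and c :: "('a, 'm) chart" and e :: 'a
    and J :: "real^'m^'m" and p :: "real poly" and m :: nat
  assumes "smooth_manifold T A"
    and "m = CARD('m)"
    and "vector_field_on A X"
    and "c \<in> A" and "e \<in> chart_domain c"
    and "hyperbolic_equilibrium c X e"
    and "J = linearisation c X e"
    and "p = characteristic_poly J"
  shows "(rsquarefree (complex_poly p) \<longrightarrow>
           (let ps = sturm_sequence p;
                as = map (\<lambda>q. coeff q 0) ps;
                bs = map lead_coeff ps;
                bs' = map (\<lambda>q. (-1) ^ degree q * lead_coeff q) ps
            in int (gamma_index J) = int (sign_var as) - int (sign_var bs) \<and>
               int (delta_index J) = int (sign_var bs') - int (sign_var as)))
       \<and> real (alpha_index J) =
           1 / 2 * (real m / 2 - wind (re_part p) (im_part p) - real (gamma_index J))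
       \<and> real (beta_index J) =
           1 / 2 * (real m / 2 + wind (re_part p) (im_part p) - real (delta_index J))"
proof -
  define P where "P = complex_poly p"
  have eig: "eigenvalue J z \<longleftrightarrow> poly P z = 0" for z
    by (simp add: P_def assms(8) eigenvalue_iff_root)
  have mult: "alg_mult J z = order z P" for z
    by (simp add: P_def assms(8) alg_mult_def)
  have hyp: "Re z \<noteq> 0" if "poly P z = 0" for z
    using assms(6) that unfolding hyperbolic_equilibrium_def assms(7)[symmetric] eig by blast
  have deg: "degree p = m"
    by (simp add: assms(2,8) degree_characteristic_poly)
  have "p \<noteq> 0"
    using deg assms(2) by auto
  then have "P \<noteq> 0"
    by (simp add: P_def map_poly_eq_0_iff)
  note indices = alpha_index_def beta_index_def gamma_index_def delta_index_def eig mult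

  have sturm: "int (gamma_index J) = int (sign_var (map (\<lambda>q. coeff q 0) (sturm_sequence p))) -
        int (sign_var (map lead_coeff (sturm_sequence p)))"
      "int (delta_index J) =
        int (sign_var (map (\<lambda>q. (-1) ^ degree q * lead_coeff q) (sturm_sequence p))) -
        int (sign_var (map (\<lambda>q. coeff q 0) (sturm_sequence p)))"
    if sqf: "rsquarefree (complex_poly p)"
  proof -
    \<comment> \<open>Hyperbolicity excludes the root 0, so the count over \<open>x \<le> 0\<close>
      from Sturm's theorem is the count of negative roots.\<close>
    have "poly p 0 \<noteq> 0"
      using hyp[of 0] poly_map_poly_of_real[of p 0, where ?'a = complex] by (auto simp: P_def)
    then have "{x. x < 0 \<and> poly p x = 0} = {x. x \<le> 0 \<and> poly p x = 0}"
      by (auto simp: order_le_less)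
    moreover have "gamma_index J = card {x. x > 0 \<and> poly p x = 0}"
        "delta_index J = card {x. x < 0 \<and> poly p x = 0}"
      unfolding indices P_def by (rule sum_order_real_roots_rsquarefree[OF sqf])+
    moreover note sturm_sequence_sign_var[OF rsquarefree_complex_poly_imp_no_common_root[OF sqf]]
    ultimately show "int (gamma_index J) = int (sign_var (map (\<lambda>q. coeff q 0) (sturm_sequence p))) -
        int (sign_var (map lead_coeff (sturm_sequence p)))"
      "int (delta_index J) =
        int (sign_var (map (\<lambda>q. (-1) ^ degree q * lead_coeff q) (sturm_sequence p))) -
        int (sign_var (map (\<lambda>q. coeff q 0) (sturm_sequence p)))"
      by simp_all
  qed
  define N_pos N_neg where "N_pos = size {#z \<in># proots P. Re z > 0#}"
    and "N_neg = size {#z \<in># proots P. Re z < 0#}"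
  have "size (proots P) = m"
    by (simp add: size_proots_complex P_def degree_map_poly deg)
  moreover have "\<forall>z\<in>#proots P. Re z \<noteq> 0"
    using hyp \<open>P \<noteq> 0\<close> by simp
  ultimately have m: "m = N_pos + N_neg"
    and wind: "wind (re_part p) (im_part p) = (real N_neg - real N_pos) / 2"
    using sum_mset_sgn_Re[of "proots P"] wind_re_im_part[OF \<open>p \<noteq> 0\<close>] hyp
    by (simp_all add: N_pos_def N_neg_def P_def)
  have N: "N_pos = 2 * alpha_index J + gamma_index J" "N_neg = 2 * beta_index J + delta_index J"
    unfolding N_pos_def N_neg_def indices P_def
    by (rule size_filter_proots_conj_pairs[OF \<open>p \<noteq> 0\<close>])+
  \<comment> \<open>Solving the two relations gives \<open>N_pos = m / 2 - wind\<close> and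
    \<open>N_neg = m / 2 + wind\<close>; removing the real roots and halving leaves the numbers of
    conjugate pairs.\<close>
  have "real (alpha_index J) = 1 / 2 * (real m / 2 - wind (re_part p) (im_part p) - real (gamma_index J))"
    "real (beta_index J) = 1 / 2 * (real m / 2 + wind (re_part p) (im_part p) - real (delta_index J))"
    unfolding m wind N by (simp_all add: field_simps)
  then show ?thesis
    unfolding Let_def using sturm by blast
qed

end
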